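(* For every instance of the $p$-center problem, $LB^{\#}=LB^{*}$, where $LB^{\#}=\min\{LB\in\mathbb R:\ \mathcal L(LB)=LB\}$ and $LB^*$ is the optimal objective function value of the mixed-integer program (PCE-R).
   Context: An instance of the $p$-center problem consists of a finite nonempty set $I$ of customer demand points, a finite nonempty set $J$ of potential facility locations, an integer $p$ with $1\le p\le |J|$, and real distances $d_{ij}\ge 0$ for $i\in I$, $j\in J$. Let $D=\{d_{ij}: i\in I, j\in J\}=\{d_1,\dots,d_K\}$ be the set of distinct distance values, with $d_1<d_2<\dots<d_K$. For $LB\in\mathbb R$, $\mathcal L(LB)$ denotes the optimal objective function value of the linear program (PCLB): minimize $z$ subject to $\sum_{j\in J}y_j=p$; $z\ge d_{ij}-\sum_{j'\in J:\,d_{ij'}<d_{ij}}(d_{ij}-\max\{LB,d_{ij'}\})y_{j'}$ for all $i\in I$, $j\in J$ with $d_{ij}>LB$; $z\ge LB$; $0\le y_j\le 1$ for all $j\in J$; $z\in\mathbb R$. (PCE-R) is the mixed-integer program: minimize $d_1+\sum_{k=2}^{K}(d_k-d_{k-1})u_k$ subject to $\sum_{j\in J}y_j\le p$; $\sum_{j\in J}y_j\ge 1$; $u_k+\sum_{j\in J:\,d_{ij}<d_k}y_j\ge 1$ for all $i\in I$, $k\in\{2,\dots,K\}$; $u_k\in\{0,1\}$ for all $k\in\{2,\dots,K\}$; $0\le y_j\le 1$ for all $j\in J$. *)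

theory Defs
  imports Complex_Main
begin

definition distance_values :: "'i set \<Rightarrow> 'j set \<Rightarrow> ('i \<Rightarrow> 'j \<Rightarrow> real) \<Rightarrow> real set" where
  "distance_values I J d = {d i j | i j. i \<in> I \<and> j \<in> J}"

definition num_dist :: "'i set \<Rightarrow> 'j set \<Rightarrow> ('i \<Rightarrow> 'j \<Rightarrow> real) \<Rightarrow> nat" where
  "num_dist I J d = card (distance_values I J d)"

(* One-based: kth_dist I J d k is d_k for 1 <= k <= K. *)
definition kth_dist :: "'i set \<Rightarrow> 'j set \<Rightarrow> ('i \<Rightarrow> 'j \<Rightarrow> real) \<Rightarrow> nat \<Rightarrow> real" where
  "kth_dist I J d k = sorted_list_of_set (distance_values I J d) ! (k - 1)"

(* Vectors y (indexed by J) and u (indexed by {2..K}) are total functions;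
   their values outside the index set are never inspected. *)

definition pclb_feasible ::
  "'i set \<Rightarrow> 'j set \<Rightarrow> nat \<Rightarrow> ('i \<Rightarrow> 'j \<Rightarrow> real) \<Rightarrow> real \<Rightarrow> ('j \<Rightarrow> real) \<Rightarrow> real \<Rightarrow> bool" where
  "pclb_feasible I J p d LB y z \<longleftrightarrow>
     (\<Sum>j\<in>J. y j) = real p \<and>
     (\<forall>i\<in>I. \<forall>j\<in>J. d i j > LB \<longrightarrow>
        z \<ge> d i j - (\<Sum>j'\<in>{j'\<in>J. d i j' < d i j}. (d i j - max LB (d i j')) * y j')) \<and>
     z \<ge> LB \<and>
     (\<forall>j\<in>J. 0 \<le> y j \<and> y j \<le> 1)"

definition pclb_values ::
  "'i set \<Rightarrow> 'j set \<Rightarrow> nat \<Rightarrow> ('i \<Rightarrow> 'j \<Rightarrow> real) \<Rightarrow> real \<Rightarrow> real set" where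
  "pclb_values I J p d LB = {z. \<exists>y. pclb_feasible I J p d LB y z}"

definition pce_r_feasible ::
  "'i set \<Rightarrow> 'j set \<Rightarrow> nat \<Rightarrow> ('i \<Rightarrow> 'j \<Rightarrow> real) \<Rightarrow> ('j \<Rightarrow> real) \<Rightarrow> (nat \<Rightarrow> real) \<Rightarrow> bool" where
  "pce_r_feasible I J p d y u \<longleftrightarrow>
     (\<Sum>j\<in>J. y j) \<le> real p \<and>
     (\<Sum>j\<in>J. y j) \<ge> 1 \<and>
     (\<forall>i\<in>I. \<forall>k\<in>{2..num_dist I J d}.
        u k + (\<Sum>j\<in>{j\<in>J. d i j < kth_dist I J d k}. y j) \<ge> 1) \<and>
     (\<forall>k\<in>{2..num_dist I J d}. u k \<in> {0, 1}) \<and>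
     (\<forall>j\<in>J. 0 \<le> y j \<and> y j \<le> 1)"

definition pce_r_objective ::
  "'i set \<Rightarrow> 'j set \<Rightarrow> ('i \<Rightarrow> 'j \<Rightarrow> real) \<Rightarrow> (nat \<Rightarrow> real) \<Rightarrow> real" where
  "pce_r_objective I J d u =
     kth_dist I J d 1 +
     (\<Sum>k\<in>{2..num_dist I J d}. (kth_dist I J d k - kth_dist I J d (k - 1)) * u k)"

definition pce_r_values ::
  "'i set \<Rightarrow> 'j set \<Rightarrow> nat \<Rightarrow> ('i \<Rightarrow> 'j \<Rightarrow> real) \<Rightarrow> real set" where
  "pce_r_values I J p d = {pce_r_objective I J d u | y u. pce_r_feasible I J p d y u}"

(* Least is a definite description, so min_value S is meaningful exactly when has_min S holds. *)

definition has_min :: "real set \<Rightarrow> bool" where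
  "has_min S \<longleftrightarrow> (\<exists>m\<in>S. \<forall>x\<in>S. m \<le> x)"

definition min_value :: "real set \<Rightarrow> real" where
  "min_value S = (LEAST x. x \<in> S)"

lemma min_value_eqI:
  assumes "m \<in> S" and "\<And>x. x \<in> S \<Longrightarrow> m \<le> x"
  shows "min_value S = m"
  unfolding min_value_def using assms by (rule Least_equality)

definition pclb_opt ::
  "'i set \<Rightarrow> 'j set \<Rightarrow> nat \<Rightarrow> ('i \<Rightarrow> 'j \<Rightarrow> real) \<Rightarrow> real \<Rightarrow> real" where
  "pclb_opt I J p d LB = min_value (pclb_values I J p d LB)"

definition pclb_fixpoints ::
  "'i set \<Rightarrow> 'j set \<Rightarrow> nat \<Rightarrow> ('i \<Rightarrow> 'j \<Rightarrow> real) \<Rightarrow> real set" where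
  "pclb_fixpoints I J p d = {LB. pclb_opt I J p d LB = LB}"

definition LB_sharp :: "'i set \<Rightarrow> 'j set \<Rightarrow> nat \<Rightarrow> ('i \<Rightarrow> 'j \<Rightarrow> real) \<Rightarrow> real" where
  "LB_sharp I J p d = min_value (pclb_fixpoints I J p d)"

definition LB_star :: "'i set \<Rightarrow> 'j set \<Rightarrow> nat \<Rightarrow> ('i \<Rightarrow> 'j \<Rightarrow> real) \<Rightarrow> real" where
  "LB_star I J p d = min_value (pce_r_values I J p d)"

end

theory Submission
  imports Defs "HOL-Analysis.Function_Topology"
begin

text \<open>
  Both numbers equal the smallest \<open>r\<close> for which \<open>p\<close> facilities, opened fractionally, can cover every
  customer within distance \<open>r\<close>: there is \<open>y\<close> with values in \<open>[0,1]\<close> and total \<open>p\<close> such that every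
  customer sees total weight at least 1 on the facilities at distance at most \<open>r\<close>
  (\<open>fractional_cover\<close>).

  For (PCLB), \<open>\<L>(LB) = LB\<close> says that \<open>z = LB\<close> is attainable. For a fixed customer \<open>i\<close>, the constraint
  belonging to the closest facility beyond \<open>LB\<close> then involves only facilities within \<open>LB\<close>, all with
  the same coefficient \<open>d i j - LB\<close>; dividing by it leaves exactly the covering condition of \<open>i\<close>. The
  constraints of the more distant facilities follow from it (\<open>pclb_attains_lower_bound_iff\<close>).

  For (PCE-R), let \<open>m\<close> be the first index with \<open>u (m + 1) = 0\<close>, or the last index of all if there is
  none. The costs of \<open>u 2, \<dots>, u m\<close>, which are all 1, telescope,
  so the objective is at least the \<open>m\<close>-th distance, and the constraints for \<open>m + 1\<close> say
  that \<open>y\<close> covers within that distance; the total weight of \<open>y\<close> can be raised to \<open>p\<close>. Conversely,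
  a fractional cover within the \<open>m\<close>-th distance gives a feasible point with
  \<open>u k = 1\<close> for \<open>k \<le> m\<close> and \<open>u k = 0\<close> beyond (\<open>pce_r_value_ge_cover_radius\<close>,
  \<open>cover_radius_in_pce_r_values\<close>).

  Whether \<open>r\<close> is a covering radius depends only on which distances are at most \<open>r\<close>, so the infimum of
  the covering radii is attained at one of the finitely many distances. The one analytic ingredient
  is that the linear program (PCLB) has an optimal solution for each \<open>LB\<close>; it comes from
  compactness of the cube \<open>[0,1]\<^sup>J\<close> (\<open>has_min_pclb_values\<close>).
\<close>

section \<open>Fractional covers\<close>

definition fractional_cover ::
  "'i set \<Rightarrow> 'j set \<Rightarrow> nat \<Rightarrow> ('i \<Rightarrow> 'j \<Rightarrow> real) \<Rightarrow> real \<Rightarrow> ('j \<Rightarrow> real) \<Rightarrow> bool" where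
  "fractional_cover I J p d r y \<longleftrightarrow>
     (\<Sum>j\<in>J. y j) = real p \<and>
     (\<forall>j\<in>J. 0 \<le> y j \<and> y j \<le> 1) \<and>
     (\<forall>i\<in>I. (\<Sum>j\<in>{j\<in>J. d i j \<le> r}. y j) \<ge> 1)"

definition cover_radii ::
  "'i set \<Rightarrow> 'j set \<Rightarrow> nat \<Rightarrow> ('i \<Rightarrow> 'j \<Rightarrow> real) \<Rightarrow> real set" where
  "cover_radii I J p d = {r. \<exists>y. fractional_cover I J p d r y}"

lemma distance_values_eq_image:
  "distance_values I J d = (\<lambda>(i, j). d i j) ` (I \<times> J)"
  unfolding distance_values_def by auto

lemma finite_distance_values:
  "finite I \<Longrightarrow> finite J \<Longrightarrow> finite (distance_values I J d)"
  by (simp add: distance_values_eq_image)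

lemma distance_values_nonempty:
  "I \<noteq> {} \<Longrightarrow> J \<noteq> {} \<Longrightarrow> distance_values I J d \<noteq> {}"
  by (auto simp: distance_values_eq_image)

lemma distance_valuesI:
  "i \<in> I \<Longrightarrow> j \<in> J \<Longrightarrow> d i j \<in> distance_values I J d"
  unfolding distance_values_def by blast

lemma uniform_weights:
  fixes J :: "'j set"
  assumes "finite J" "J \<noteq> {}" "p \<le> card J"
  shows "(\<Sum>j\<in>J. real p / real (card J)) = real p"
    and "0 \<le> real p / real (card J)" "real p / real (card J) \<le> 1"
  using assms by (auto simp: divide_le_eq)

lemma max_distance_in_cover_radii:
  assumes "finite I" "I \<noteq> {}" "finite J" "J \<noteq> {}" "1 \<le> p" "p \<le> card J"
  shows "Max (distance_values I J d) \<in> cover_radii I J p d"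
proof -
  have "{j \<in> J. d i j \<le> Max (distance_values I J d)} = J" if "i \<in> I" for i
    using that assms by (auto intro!: Max_ge finite_distance_values distance_valuesI)
  then have "fractional_cover I J p d (Max (distance_values I J d)) (\<lambda>_. real p / real (card J))"
    unfolding fractional_cover_def using assms uniform_weights[of J p] by auto
  then show ?thesis
    unfolding cover_radii_def by blast
qed

text \<open>
  Rounding a covering radius down to the nearest distance leaves each set of facilities within
  that radius unchanged. There is such a distance, since below the smallest one nothing is covered.
\<close>

lemma cover_radius_round_down:
  assumes "finite I" "I \<noteq> {}" "finite J" "J \<noteq> {}" and r: "r \<in> cover_radii I J p d"
  obtains x where "x \<in> distance_values I J d" "x \<in> cover_radii I J p d" "x \<le> r"
proof -
  define S where "S = {x \<in> distance_values I J d. x \<le> r}"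
  obtain y where y: "fractional_cover I J p d r y"
    using r unfolding cover_radii_def by blast
  obtain i where i: "i \<in> I"
    using assms by blast
  have "(\<Sum>j\<in>{j\<in>J. d i j \<le> r}. y j) \<ge> 1"
    using y i unfolding fractional_cover_def by blast
  then have "{j\<in>J. d i j \<le> r} \<noteq> {}"
    by (metis sum.empty not_one_le_zero)
  then have "S \<noteq> {}"
    using i unfolding S_def by (auto intro: distance_valuesI)
  moreover have fin: "finite S"
    using assms by (simp add: S_def finite_distance_values)
  ultimately have M: "Max S \<in> S"
    by simp
  have "{j\<in>J. d i j \<le> Max S} = {j\<in>J. d i j \<le> r}" if "i \<in> I" for i
  proof -
    have "d i j \<le> Max S" if "j \<in> J" "d i j \<le> r" for j
      using that \<open>i \<in> I\<close> fin by (auto simp: S_def intro!: Max_ge distance_valuesI)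
    then show ?thesis
      using M unfolding S_def by fastforce
  qed
  then have "fractional_cover I J p d (Max S) y"
    using y unfolding fractional_cover_def by simp
  then show thesis
    using that M unfolding S_def cover_radii_def by blast
qed

section \<open>The linear program (PCLB)\<close>

text \<open>
  The constraints ignore the coordinates of \<open>y\<close> outside \<open>J\<close>, so these may be set to 0; and \<open>z\<close> may be
  bounded by a value \<open>M\<close> that is feasible together with uniform weights. What remains of the feasible
  set is a closed subset of a compact box, on which \<open>z\<close> attains its minimum.
\<close>

lemma has_min_pclb_values:
  fixes I :: "'i set" and J :: "'j set"
  assumes "finite I" "finite J" "J \<noteq> {}" "p \<le> card J"
  shows "has_min (pclb_values I J p d LB)"
proof -
  define M where "M = Max (insert LB (distance_values I J d))"
  have M: "LB \<le> M" "\<And>i j. i \<in> I \<Longrightarrow> j \<in> J \<Longrightarrow> d i j \<le> M"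
    using assms by (auto simp: M_def finite_distance_values intro!: Max_ge distance_valuesI)
  define u where "u = (\<lambda>j. if j \<in> J then real p / real (card J) else 0)"
  define B where "B = (PiE UNIV (\<lambda>j. if j \<in> J then {0..1} else {0}) :: ('j \<Rightarrow> real) set) \<times> {LB..M}"
  define C where "C = {w :: ('j \<Rightarrow> real) \<times> real. pclb_feasible I J p d LB (fst w) (snd w)}"
  have "compactin (product_topology (\<lambda>_::'j. euclideanreal) UNIV)
          (PiE UNIV (\<lambda>j. if j \<in> J then {0..1} else {0}))"
    by (simp add: compactin_PiE)
  then have "compact B"
    unfolding B_def by (intro compact_Times) (simp_all add: euclidean_product_topology)
  have cont: "continuous_on UNIV (\<lambda>w :: ('j \<Rightarrow> real) \<times> real. fst w j)" for j
    by (rule continuous_on_product_then_coordinatewise) (intro continuous_intros)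
  have "closed C"
  proof -
    have "C = {w. (\<Sum>j\<in>J. fst w j) = real p} \<inter>
        (\<Inter>i\<in>I. \<Inter>j\<in>{j\<in>J. d i j > LB}.
          {w. d i j - (\<Sum>j'\<in>{j'\<in>J. d i j' < d i j}. (d i j - max LB (d i j')) * fst w j') \<le> snd w}) \<inter>
        {w. LB \<le> snd w} \<inter> (\<Inter>j\<in>J. {w. 0 \<le> fst w j} \<inter> {w. fst w j \<le> 1})"
      unfolding C_def pclb_feasible_def by auto
    also have "closed \<dots>"
      by (intro closed_Int closed_INT ballI closed_Collect_eq closed_Collect_le continuous_intros cont)
    finally show ?thesis .
  qed
  then have "compact (B \<inter> C)"
    using \<open>compact B\<close> by blast
  moreover have "(u, M) \<in> B \<inter> C"
  proof -
    have u: "0 \<le> u j" "u j \<le> 1" for j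
      using uniform_weights[of J p] assms by (auto simp: u_def)
    have "d i j - (\<Sum>j'\<in>{j'\<in>J. d i j' < d i j}. (d i j - max LB (d i j')) * u j') \<le> M"
      if "i \<in> I" "j \<in> J" "LB < d i j" for i j
    proof -
      have "0 \<le> (\<Sum>j'\<in>{j'\<in>J. d i j' < d i j}. (d i j - max LB (d i j')) * u j')"
        using that u by (intro sum_nonneg mult_nonneg_nonneg) auto
      then show ?thesis
        using M(2)[of i j] that by linarith
    qed
    moreover have "(\<Sum>j\<in>J. u j) = real p"
      using uniform_weights(1)[of J p] assms by (simp add: u_def)
    ultimately have "(u, M) \<in> C"
      using u M(1) unfolding C_def pclb_feasible_def by simp
    moreover have "u \<in> PiE UNIV (\<lambda>j. if j \<in> J then {0..1} else {0})"
    proof (rule PiE_I)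
      fix j
      have "j \<notin> J \<Longrightarrow> u j = 0"
        by (simp add: u_def)
      then show "u j \<in> (if j \<in> J then {0..1} else {0})"
        using u[of j] by auto
    qed simp
    ultimately show ?thesis
      using M(1) unfolding B_def by simp
  qed
  ultimately obtain w where w: "w \<in> B \<inter> C" "\<And>v. v \<in> B \<inter> C \<Longrightarrow> snd w \<le> snd v"
    using continuous_attains_inf[of "B \<inter> C" snd] continuous_on_snd[OF continuous_on_id] by blast
  have "snd w \<le> z" if z: "z \<in> pclb_values I J p d LB" for z
  proof (cases "z \<le> M")
    case True
    obtain y where y: "pclb_feasible I J p d LB y z"
      using z unfolding pclb_values_def by blast
    define y' where "y' j = (if j \<in> J then y j else 0)" for j
    have "pclb_feasible I J p d LB y' z"
      using y unfolding pclb_feasible_def y'_def by simp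
    then have "(y', z) \<in> B \<inter> C"
      using True unfolding B_def C_def pclb_feasible_def by (auto simp: y'_def)
    then show ?thesis
      using w(2) by fastforce
  next
    case False
    then show ?thesis
      using w(1) unfolding B_def by auto
  qed
  moreover have "snd w \<in> pclb_values I J p d LB"
    using w(1) unfolding C_def pclb_values_def by auto
  ultimately show ?thesis
    unfolding has_min_def by blast
qed

text \<open>
  The constraint of a facility \<open>j\<close> beyond \<open>LB\<close> bounds \<open>LB\<close> through a sum in which facilities within
  \<open>LB\<close> have coefficient \<open>d i j - LB\<close> and the others a smaller nonnegative one. Hence covering
  implies all the constraints. For the closest such \<open>j\<close> only the facilities within \<open>LB\<close> remain in the
  sum, which gives the converse. If no facility lies beyond \<open>LB\<close>, the customer is covered because \<open>p \<ge> 1\<close>.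
\<close>

lemma pclb_attains_lower_bound_iff:
  fixes I :: "'i set" and J :: "'j set"
  assumes "finite J" "1 \<le> p"
  shows "pclb_feasible I J p d LB y LB \<longleftrightarrow> fractional_cover I J p d LB y"
proof
  assume L: "pclb_feasible I J p d LB y LB"
  have "(\<Sum>j\<in>{j\<in>J. d i j \<le> LB}. y j) \<ge> 1" if i: "i \<in> I" for i
  proof (cases "\<exists>j\<in>J. d i j > LB")
    case True
    define A where "A = {j\<in>J. d i j > LB}"
    have A: "finite A" "A \<noteq> {}"
      using True assms by (auto simp: A_def)
    define j where "j = arg_min_on (d i) A"
    have j: "j \<in> J" "d i j > LB" and least: "\<And>j'. j' \<in> J \<Longrightarrow> LB < d i j' \<Longrightarrow> d i j \<le> d i j'"
      using arg_min_if_finite(1)[OF A, of "d i"] arg_min_least[OF A, of _ "d i"]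
      by (auto simp: j_def A_def)
    have near: "{j'\<in>J. d i j' < d i j} = {j'\<in>J. d i j' \<le> LB}"
      using j least by force
    have "LB \<ge> d i j - (\<Sum>j'\<in>{j'\<in>J. d i j' \<le> LB}. (d i j - max LB (d i j')) * y j')"
      using L i j unfolding pclb_feasible_def near[symmetric] by blast
    also have "(\<Sum>j'\<in>{j'\<in>J. d i j' \<le> LB}. (d i j - max LB (d i j')) * y j')
             = (d i j - LB) * (\<Sum>j'\<in>{j'\<in>J. d i j' \<le> LB}. y j')"
      unfolding sum_distrib_left by (intro sum.cong) auto
    finally have "(d i j - LB) * 1 \<le> (d i j - LB) * (\<Sum>j'\<in>{j'\<in>J. d i j' \<le> LB}. y j')"
      by simp
    then show ?thesis
      using j by (simp only: mult_le_cancel_left_pos diff_gt_0_iff_gt)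
  next
    case False
    then have "{j\<in>J. d i j \<le> LB} = J"
      by force
    then show ?thesis
      using L assms unfolding pclb_feasible_def by simp
  qed
  then show "fractional_cover I J p d LB y"
    using L unfolding pclb_feasible_def fractional_cover_def by blast
next
  assume C: "fractional_cover I J p d LB y"
  have "d i j - (\<Sum>j'\<in>{j'\<in>J. d i j' < d i j}. (d i j - max LB (d i j')) * y j') \<le> LB"
    if "i \<in> I" "j \<in> J" "LB < d i j" for i j
  proof -
    have "(d i j - LB) * 1 \<le> (d i j - LB) * (\<Sum>j'\<in>{j'\<in>J. d i j' \<le> LB}. y j')"
      using C that unfolding fractional_cover_def by (intro mult_left_mono) auto
    also have "\<dots> = (\<Sum>j'\<in>{j'\<in>J. d i j' \<le> LB}. (d i j - max LB (d i j')) * y j')"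
      unfolding sum_distrib_left by (intro sum.cong) auto
    also have "\<dots> \<le> (\<Sum>j'\<in>{j'\<in>J. d i j' < d i j}. (d i j - max LB (d i j')) * y j')"
      using that assms C by (intro sum_mono2) (auto simp: fractional_cover_def)
    finally show ?thesis
      by simp
  qed
  then show "pclb_feasible I J p d LB y LB"
    using C unfolding pclb_feasible_def fractional_cover_def by blast
qed

lemma pclb_fixpoints_eq_cover_radii:
  assumes "finite I" "finite J" "J \<noteq> {}" "1 \<le> p" "p \<le> card J"
  shows "pclb_fixpoints I J p d = cover_radii I J p d"
proof -
  have "pclb_opt I J p d LB = LB \<longleftrightarrow> LB \<in> pclb_values I J p d LB" for LB
  proof
    obtain m where m: "m \<in> pclb_values I J p d LB" "\<forall>z\<in>pclb_values I J p d LB. m \<le> z"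
      using has_min_pclb_values[of I J p d LB] assms unfolding has_min_def by blast
    have "pclb_opt I J p d LB = m"
      unfolding pclb_opt_def using m by (auto intro: min_value_eqI)
    moreover assume "pclb_opt I J p d LB = LB"
    ultimately show "LB \<in> pclb_values I J p d LB"
      using m by simp
  next
    assume "LB \<in> pclb_values I J p d LB"
    then show "pclb_opt I J p d LB = LB"
      unfolding pclb_opt_def
      by (rule min_value_eqI) (auto simp: pclb_values_def pclb_feasible_def)
  qed
  then show ?thesis
    using assms
    by (simp add: pclb_fixpoints_def cover_radii_def pclb_values_def pclb_attains_lower_bound_iff)
qed

section \<open>The enumeration of the distances\<close>

lemma kth_dist_less_iff:
  assumes "k \<in> {1..num_dist I J d}" "l \<in> {1..num_dist I J d}"
  shows "kth_dist I J d k < kth_dist I J d l \<longleftrightarrow> k < l"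
proof -
  let ?xs = "sorted_list_of_set (distance_values I J d)"
  have less: "?xs ! a < ?xs ! b" if "a < b" "b < num_dist I J d" for a b
    using that by (intro sorted_wrt_nth_less[OF strict_sorted_list_of_set]) (simp_all add: num_dist_def)
  have mono: "kth_dist I J d a < kth_dist I J d b" if "1 \<le> a" "a < b" "b \<le> num_dist I J d" for a b
    unfolding kth_dist_def using that by (intro less) auto
  show ?thesis
  proof (cases k l rule: linorder_cases)
    case less
    then show ?thesis
      using mono[of k l] assms by simp
  next
    case equal
    then show ?thesis
      by simp
  next
    case greater
    then have "kth_dist I J d l < kth_dist I J d k"
      using mono[of l k] assms by simp
    then show ?thesis
      using greater by simp
  qed
qed

lemma kth_dist_image:
  assumes "finite (distance_values I J d)"
  shows "kth_dist I J d ` {1..num_dist I J d} = distance_values I J d"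
proof -
  let ?xs = "sorted_list_of_set (distance_values I J d)"
  have "{1..num_dist I J d} = Suc ` {..<length ?xs}"
    by (simp add: num_dist_def image_Suc_lessThan)
  then have "kth_dist I J d ` {1..num_dist I J d} = (!) ?xs ` {..<length ?xs}"
    by (simp add: image_image kth_dist_def)
  also have "\<dots> = set ?xs"
    by (auto simp: set_conv_nth)
  finally show ?thesis
    using assms by simp
qed

lemma distance_less_kth_dist_iff:
  assumes "finite I" "finite J" "i \<in> I" "j \<in> J" "1 \<le> m" "m < num_dist I J d"
  shows "d i j < kth_dist I J d (m + 1) \<longleftrightarrow> d i j \<le> kth_dist I J d m"
proof -
  have "d i j \<in> kth_dist I J d ` {1..num_dist I J d}"
    using distance_valuesI[of i I j J d] kth_dist_image[of I J d] finite_distance_values[of I J d] assms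
    by blast
  then obtain k where k: "k \<in> {1..num_dist I J d}" "d i j = kth_dist I J d k"
    by blast
  have "kth_dist I J d k < kth_dist I J d (m + 1) \<longleftrightarrow> k < m + 1"
    using k assms by (intro kth_dist_less_iff) auto
  moreover have "kth_dist I J d m < kth_dist I J d k \<longleftrightarrow> m < k"
    using k assms by (intro kth_dist_less_iff) auto
  ultimately show ?thesis
    unfolding k(2) by linarith
qed

lemma distance_le_kth_dist_num_dist:
  assumes "finite I" "finite J" "i \<in> I" "j \<in> J"
  shows "d i j \<le> kth_dist I J d (num_dist I J d)"
proof -
  have "d i j \<in> kth_dist I J d ` {1..num_dist I J d}"
    using distance_valuesI[of i I j J d] kth_dist_image[of I J d] finite_distance_values[of I J d] assms
    by blast
  then obtain k where k: "k \<in> {1..num_dist I J d}" "d i j = kth_dist I J d k"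
    by blast
  then have "kth_dist I J d (num_dist I J d) < kth_dist I J d k \<longleftrightarrow> num_dist I J d < k"
    by (intro kth_dist_less_iff) auto
  then show ?thesis
    using k by simp
qed

lemma kth_dist_telescope:
  assumes "1 \<le> m"
  shows "kth_dist I J d 1 + (\<Sum>k\<in>{2..m}. kth_dist I J d k - kth_dist I J d (k - 1)) = kth_dist I J d m"
  using assms by (induction m rule: dec_induct) simp_all

section \<open>The mixed-integer program (PCE-R)\<close>

text \<open>
  The weights are moved towards 1 along the segment from \<open>y\<close> to the all-one vector, whose total
  \<open>card J\<close> is at least \<open>p\<close>.
\<close>

lemma raise_weights_to_sum:
  fixes y :: "'j \<Rightarrow> real"
  assumes "finite J" "p \<le> card J" "(\<Sum>j\<in>J. y j) \<le> real p" "\<And>j. j \<in> J \<Longrightarrow> y j \<le> 1"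
  obtains y' where "(\<Sum>j\<in>J. y' j) = real p" "\<And>j. j \<in> J \<Longrightarrow> y j \<le> y' j \<and> y' j \<le> 1"
proof -
  define s where "s = (\<Sum>j\<in>J. y j)"
  \<comment> \<open>If \<open>card J = s\<close>, then \<open>y\<close> has total \<open>p\<close> already; division by zero gives \<open>t = 0\<close>, as it should.\<close>
  define t where "t = (real p - s) / (real (card J) - s)"
  have s: "s \<le> real p" "real p \<le> real (card J)"
    using assms by (auto simp: s_def)
  then have t: "0 \<le> t" "t \<le> 1"
    by (auto simp: t_def divide_le_eq)
  show thesis
  proof
    have "(\<Sum>j\<in>J. y j + t * (1 - y j)) = s + t * (real (card J) - s)"
      by (simp add: sum.distrib sum_distrib_left[symmetric] sum_subtractf s_def)
    also have "\<dots> = real p"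
      using s by (auto simp: t_def)
    finally show "(\<Sum>j\<in>J. y j + t * (1 - y j)) = real p" .
    show "y j \<le> y j + t * (1 - y j) \<and> y j + t * (1 - y j) \<le> 1" if "j \<in> J" for j
      using t assms(4)[OF that] mult_right_mono[of t 1 "1 - y j"] by auto
  qed
qed

text \<open>
  The radius is the distance just below the first one that \<open>u\<close> does not pay for. It is a covering
  radius because \<open>d i j < d\<^sub>m\<^sub>+\<^sub>1\<close> means the same as \<open>d i j \<le> d\<^sub>m\<close> for consecutive distances; if \<open>u\<close> pays
  for all of them, the radius is the largest distance and total weight at least 1 suffices.
\<close>

lemma pce_r_value_ge_cover_radius:
  assumes fin: "finite I" "finite J" and ne: "I \<noteq> {}" "J \<noteq> {}" and "p \<le> card J"
    and v: "v \<in> pce_r_values I J p d"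
  obtains r where "r \<in> cover_radii I J p d" "r \<in> distance_values I J d" "r \<le> v"
proof -
  obtain y u where feas: "pce_r_feasible I J p d y u" and v: "v = pce_r_objective I J d u"
    using v unfolding pce_r_values_def by blast
  define K where "K = num_dist I J d"
  define e where "e = kth_dist I J d"
  have "1 \<le> K"
    using fin ne distance_values_nonempty[of I J d] finite_distance_values[of I J d]
    by (simp add: K_def num_dist_def Suc_le_eq card_gt_0_iff)
  \<comment> \<open>Stopping at the first zero of \<open>u\<close> is needed because later entries may be 1 again: they only add
    cost, while the constraints at the first zero already force covering.\<close>
  define P where "P m \<longleftrightarrow> 1 \<le> m \<and> (m = K \<or> u (m + 1) = 0)" for m
  define m where "m = (LEAST m. P m)"
  have "P K"
    using \<open>1 \<le> K\<close> by (simp add: P_def)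
  then have "P m" "m \<le> K"
    unfolding m_def by (auto intro: LeastI Least_le)
  then have m: "1 \<le> m" "m \<le> K" "m = K \<or> u (m + 1) = 0"
    by (auto simp: P_def)
  have u: "u k \<in> {0, 1}" if "k \<in> {2..K}" for k
    using that feas by (auto simp: pce_r_feasible_def K_def)
  have u1: "u k = 1" if "k \<in> {2..m}" for k
  proof -
    have "\<not> P (k - 1)"
    proof (rule not_less_Least[of "k - 1" P, folded m_def])
      show "k - 1 < m"
        using that unfolding atLeastAtMost_iff by linarith
    qed
    then show ?thesis
      using that u[of k] m by (auto simp: P_def)
  qed
  have "e m \<le> v"
  proof -
    have "e m = e 1 + (\<Sum>k\<in>{2..m}. (e k - e (k - 1)) * u k)"
      using kth_dist_telescope[of m I J d] m u1 by (simp add: e_def)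
    also have "(\<Sum>k\<in>{2..m}. (e k - e (k - 1)) * u k) \<le> (\<Sum>k\<in>{2..K}. (e k - e (k - 1)) * u k)"
    proof (intro sum_mono2)
      fix k
      assume k: "k \<in> {2..K} - {2..m}"
      then have "k - 1 \<in> {1..K}" "k \<in> {1..K}" "k - 1 < k"
        by auto
      then have "e (k - 1) < e k"
        using kth_dist_less_iff[of "k - 1" I J d k] by (simp only: e_def K_def)
      then show "0 \<le> (e k - e (k - 1)) * u k"
        using u[of k] k by auto
    qed (use m in auto)
    finally show ?thesis
      by (simp add: v pce_r_objective_def e_def K_def)
  qed
  moreover have "e m \<in> cover_radii I J p d"
  proof -
    have y: "(\<Sum>j\<in>J. y j) \<le> real p" "1 \<le> (\<Sum>j\<in>J. y j)" "\<And>j. j \<in> J \<Longrightarrow> 0 \<le> y j \<and> y j \<le> 1"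
      using feas by (auto simp: pce_r_feasible_def)
    have cov: "1 \<le> (\<Sum>j\<in>{j\<in>J. d i j \<le> e m}. y j)" if i: "i \<in> I" for i
    proof (cases "m = K")
      case True
      then have "{j\<in>J. d i j \<le> e m} = J"
        using i fin distance_le_kth_dist_num_dist[of I J i _ d] by (auto simp: e_def K_def)
      then show ?thesis
        using y by simp
    next
      case False
      then have "m + 1 \<in> {2..K}"
        using m by auto
      then have "1 \<le> u (m + 1) + (\<Sum>j\<in>{j\<in>J. d i j < e (m + 1)}. y j)"
        using feas i unfolding pce_r_feasible_def e_def K_def by blast
      moreover have "{j\<in>J. d i j < e (m + 1)} = {j\<in>J. d i j \<le> e m}"
        using distance_less_kth_dist_iff[of I J i _ m d] fin i m False by (auto simp: e_def K_def)
      ultimately show ?thesis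
        using m False by simp
    qed
    obtain y' where y': "(\<Sum>j\<in>J. y' j) = real p" "\<And>j. j \<in> J \<Longrightarrow> y j \<le> y' j \<and> y' j \<le> 1"
      using raise_weights_to_sum[of J p y] assms y by blast
    have "1 \<le> (\<Sum>j\<in>{j\<in>J. d i j \<le> e m}. y' j)" if "i \<in> I" for i
    proof -
      have "(\<Sum>j\<in>{j\<in>J. d i j \<le> e m}. y j) \<le> (\<Sum>j\<in>{j\<in>J. d i j \<le> e m}. y' j)"
        using y' by (intro sum_mono) auto
      then show ?thesis
        using cov[OF that] by linarith
    qed
    then have "fractional_cover I J p d (e m) y'"
      using y y' unfolding fractional_cover_def by force
    then show ?thesis
      unfolding cover_radii_def by blast
  qed
  moreover have "e m \<in> distance_values I J d"
    using kth_dist_image[of I J d] finite_distance_values[OF fin] m by (auto simp: e_def K_def)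
  ultimately show thesis
    using that by blast
qed

text \<open>
  The entry \<open>u k\<close> records whether the \<open>k\<close>-th distance is at most \<open>r\<close>; a constraint with \<open>u k = 0\<close> then
  counts at least all facilities within \<open>r\<close>.
\<close>

lemma cover_radius_in_pce_r_values:
  assumes fin: "finite I" "finite J" and "1 \<le> p"
    and r: "r \<in> cover_radii I J p d" "r \<in> distance_values I J d"
  shows "r \<in> pce_r_values I J p d"
proof -
  obtain y where y: "fractional_cover I J p d r y"
    using r unfolding cover_radii_def by blast
  obtain m where m: "1 \<le> m" "m \<le> num_dist I J d" "r = kth_dist I J d m"
    using r kth_dist_image[of I J d] finite_distance_values[OF fin, of d] by force
  define u :: "nat \<Rightarrow> real" where "u k = (if k \<le> m then 1 else 0)" for k
  have "1 \<le> u k + (\<Sum>j\<in>{j\<in>J. d i j < kth_dist I J d k}. y j)"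
    if "i \<in> I" "k \<in> {2..num_dist I J d}" for i k
  proof -
    have nonneg: "0 \<le> y j" if "j \<in> J" for j
      using y that by (simp add: fractional_cover_def)
    show ?thesis
    proof (cases "k \<le> m")
      case True
      have "0 \<le> (\<Sum>j\<in>{j\<in>J. d i j < kth_dist I J d k}. y j)"
        using nonneg by (intro sum_nonneg) auto
      then show ?thesis
        using True by (simp add: u_def)
    next
      case False
      then have "r < kth_dist I J d k"
        using kth_dist_less_iff[of m I J d k] m that by auto
      have "1 \<le> (\<Sum>j\<in>{j\<in>J. d i j \<le> r}. y j)"
        using y that by (simp add: fractional_cover_def)
      also have "\<dots> \<le> (\<Sum>j\<in>{j\<in>J. d i j < kth_dist I J d k}. y j)"
        using \<open>r < kth_dist I J d k\<close> fin nonneg by (intro sum_mono2) auto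
      finally show ?thesis
        using False by (simp add: u_def)
    qed
  qed
  then have "pce_r_feasible I J p d y u"
    using y \<open>1 \<le> p\<close> unfolding pce_r_feasible_def fractional_cover_def by (auto simp: u_def)
  moreover have "pce_r_objective I J d u = r"
  proof -
    have "(\<Sum>k\<in>{2..num_dist I J d}. (kth_dist I J d k - kth_dist I J d (k - 1)) * u k)
        = (\<Sum>k\<in>{2..m}. kth_dist I J d k - kth_dist I J d (k - 1))"
      using m by (intro sum.mono_neutral_cong_right) (auto simp: u_def)
    then show ?thesis
      using kth_dist_telescope[of m I J d] m by (simp add: pce_r_objective_def)
  qed
  ultimately show ?thesis
    unfolding pce_r_values_def by blast
qed

section \<open>Equality of the two bounds\<close>

theorem theorem13:
  fixes I :: "'i set" and J :: "'j set" and p :: nat and d :: "'i \<Rightarrow> 'j \<Rightarrow> real"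
  assumes "finite I" and "I \<noteq> {}"
    and "finite J" and "J \<noteq> {}"
    and "1 \<le> p" and "p \<le> card J"
    and "\<And>i j. i \<in> I \<Longrightarrow> j \<in> J \<Longrightarrow> 0 \<le> d i j"
  shows "(\<forall>LB. has_min (pclb_values I J p d LB)) \<and>
         has_min (pclb_fixpoints I J p d) \<and>
         has_min (pce_r_values I J p d) \<and>
         LB_sharp I J p d = LB_star I J p d"
proof -
  define S where "S = cover_radii I J p d \<inter> distance_values I J d"
  have fin: "finite S"
    using assms by (simp add: S_def finite_distance_values)
  have "Max (distance_values I J d) \<in> S"
    using assms by (simp add: S_def max_distance_in_cover_radii finite_distance_values
        distance_values_nonempty)
  then have "Min S \<in> S"
    using fin by (intro Min_in) auto
  have fix_eq: "pclb_fixpoints I J p d = cover_radii I J p d"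
    using assms by (intro pclb_fixpoints_eq_cover_radii)
  have fix_mem: "Min S \<in> pclb_fixpoints I J p d"
    using \<open>Min S \<in> S\<close> by (simp add: fix_eq S_def)
  have fix_le: "Min S \<le> r" if r: "r \<in> pclb_fixpoints I J p d" for r
  proof -
    obtain x where "x \<in> S" "x \<le> r"
      using cover_radius_round_down[OF assms(1-4) r[unfolded fix_eq]] unfolding S_def by blast
    then show ?thesis
      using fin by (meson Min_le order_trans)
  qed
  have pce_mem: "Min S \<in> pce_r_values I J p d"
    using \<open>Min S \<in> S\<close> assms cover_radius_in_pce_r_values[of I J p "Min S" d] by (simp add: S_def)
  have pce_le: "Min S \<le> v" if v: "v \<in> pce_r_values I J p d" for v
  proof -
    obtain x where "x \<in> S" "x \<le> v"
      using pce_r_value_ge_cover_radius[OF assms(1,3,2,4,6) v] unfolding S_def by blast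
    then show ?thesis
      using fin by (meson Min_le order_trans)
  qed
  have "LB_sharp I J p d = Min S" "LB_star I J p d = Min S"
    unfolding LB_sharp_def LB_star_def
    using fix_mem fix_le pce_mem pce_le by (auto intro: min_value_eqI)
  moreover have "\<forall>LB. has_min (pclb_values I J p d LB)"
    using assms by (intro allI has_min_pclb_values)
  moreover have "has_min (pclb_fixpoints I J p d)" "has_min (pce_r_values I J p d)"
    using fix_mem fix_le pce_mem pce_le unfolding has_min_def by blast+
  ultimately show ?thesis
    by simp
qed

end
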